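(* Let $\mathcal F$ be a nonempty weak Fraïssé class. Then there exists a unique, up to isomorphism, structure $G \in \sigma\mathcal F$ that is weakly $\mathcal F$-injective and such that $\mathcal F$ is cofinal in $\mathrm{Age}(G)$. Conversely, if $G$ is a countable weakly injective structure, then every cofinal subclass of $\mathrm{Age}(G)$ (closed under isomorphisms) is a weak Fraïssé class.
   Context: Fix a countable first-order signature. All classes $\mathcal F$ below are classes, closed under isomorphisms, of countable finitely generated structures in this signature. $X \leq Y$ means that $X$ is a substructure of $Y$. $\sigma\mathcal F$ is the class of all structures of the form $\bigcup_{n\in\omega} X_n$, where $X_0 \leq X_1 \leq X_2 \leq \cdots$ is a chain of structures from $\mathcal F$. $\mathrm{Age}(G)$ is the class of all finitely generated structures embeddable into $G$. A subclass $\mathcal F'$ of a class $\mathcal F$ is cofinal in $\mathcal F$ if every $X \in \mathcal F$ is a substructure of some $Y \in \mathcal F'$. $\mathcal F$ has the joint embedding property (JEP) if for all $X, Y \in \mathcal F$ there is $Z \in \mathcal F$ such that both $X$ and $Y$ embed into $Z$. $\mathcal F$ has the weak amalgamation property (WAP) if for every $Z \in \mathcal F$ there is $Z' \in \mathcal F$ with $Z \leq Z'$ such that for all embeddings $f\colon Z' \to X$, $g\colon Z' \to Y$ with $X, Y \in \mathcal F$ there exist $V \in \mathcal F$ and embeddings $f'\colon X \to V$, $g'\colon Y \to V$ satisfying $f'\circ f \restriction Z = g' \circ g\restriction Z$. $\mathcal F$ is a weak Fraïssé class if it has the JEP, the WAP, and contains only countably many isomorphism types. A structure $G \in \sigma\mathcal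 F$ is weakly $\mathcal F$-injective if every structure from $\mathcal F$ embeds into $G$ and, for every $A \leq G$ with $A \in \mathcal F$, there is $B \in \mathcal F$ such that $A \leq B \leq G$ and for every $X \in \mathcal F$ with $B \leq X$ there exists an embedding $f\colon X \to G$ with $f\restriction A = \mathrm{id}_A$. A structure $G$ is weakly injective if it is weakly $\mathcal F$-injective with $\mathcal F = \mathrm{Age}(G)$. *)

theory Defs
  imports Main "HOL-Library.Countable_Set"
begin

text \<open>
  Symbols are given by sets rather than whole types, so that a signature may lack function
  symbols or relation symbols altogether. Constants are function symbols of arity 0.
\<close>

record ('f, 'r) signature =
  fun_syms :: "'f set"
  rel_syms :: "'r set"
  fun_arity :: "'f \<Rightarrow> nat"
  rel_arity :: "'r \<Rightarrow> nat"

definition countable_signature :: "('f, 'r) signature \<Rightarrow> bool" where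
  "countable_signature L \<longleftrightarrow> countable (fun_syms L) \<and> countable (rel_syms L)"

record ('u, 'f, 'r) fo_struct =
  carrier :: "'u set"
  fun_int :: "'f \<Rightarrow> 'u list \<Rightarrow> 'u"
  rel_int :: "'r \<Rightarrow> 'u list \<Rightarrow> bool"

definition tuples :: "nat \<Rightarrow> 'u set \<Rightarrow> 'u list set" where
  "tuples n A = {xs. length xs = n \<and> set xs \<subseteq> A}"

text \<open>
  The last two conjuncts normalise the interpretations outside their mathematical domains, so
  that equality of HOL records is equality of structures. The carrier may be empty if the
  signature has no constants.
\<close>

definition is_structure :: "('f, 'r) signature \<Rightarrow> ('u, 'f, 'r) fo_struct \<Rightarrow> bool" where
  "is_structure L M \<longleftrightarrow>
     (\<forall>f\<in>fun_syms L. \<forall>xs\<in>tuples (fun_arity L f) (carrier M). fun_int M f xs \<in> carrier M) \<and>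
     (\<forall>f xs. \<not> (f \<in> fun_syms L \<and> xs \<in> tuples (fun_arity L f) (carrier M))
        \<longrightarrow> fun_int M f xs = undefined) \<and>
     (\<forall>r xs. \<not> (r \<in> rel_syms L \<and> xs \<in> tuples (rel_arity L r) (carrier M))
        \<longrightarrow> \<not> rel_int M r xs)"

definition substructure ::
  "('f, 'r) signature \<Rightarrow> ('u, 'f, 'r) fo_struct \<Rightarrow> ('u, 'f, 'r) fo_struct \<Rightarrow> bool" where
  "substructure L X Y \<longleftrightarrow> is_structure L X \<and> is_structure L Y \<and> carrier X \<subseteq> carrier Y \<and>
     (\<forall>f\<in>fun_syms L. \<forall>xs\<in>tuples (fun_arity L f) (carrier X). fun_int X f xs = fun_int Y f xs) \<and>
     (\<forall>r\<in>rel_syms L. \<forall>xs\<in>tuples (rel_arity L r) (carrier X). rel_int X r xs \<longleftrightarrow> rel_int Y r xs)"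

text \<open>Only the values of \<open>h\<close> on the carrier of \<open>X\<close> matter.\<close>

definition embedding ::
  "('f, 'r) signature \<Rightarrow> ('u \<Rightarrow> 'v) \<Rightarrow> ('u, 'f, 'r) fo_struct \<Rightarrow> ('v, 'f, 'r) fo_struct \<Rightarrow> bool" where
  "embedding L h X Y \<longleftrightarrow> is_structure L X \<and> is_structure L Y \<and>
     h ` carrier X \<subseteq> carrier Y \<and> inj_on h (carrier X) \<and>
     (\<forall>f\<in>fun_syms L. \<forall>xs\<in>tuples (fun_arity L f) (carrier X).
        h (fun_int X f xs) = fun_int Y f (map h xs)) \<and>
     (\<forall>r\<in>rel_syms L. \<forall>xs\<in>tuples (rel_arity L r) (carrier X).
        rel_int X r xs \<longleftrightarrow> rel_int Y r (map h xs))"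

definition embeds ::
  "('f, 'r) signature \<Rightarrow> ('u, 'f, 'r) fo_struct \<Rightarrow> ('v, 'f, 'r) fo_struct \<Rightarrow> bool" where
  "embeds L X Y \<longleftrightarrow> (\<exists>h. embedding L h X Y)"

definition isomorphic ::
  "('f, 'r) signature \<Rightarrow> ('u, 'f, 'r) fo_struct \<Rightarrow> ('v, 'f, 'r) fo_struct \<Rightarrow> bool" where
  "isomorphic L X Y \<longleftrightarrow> (\<exists>h. embedding L h X Y \<and> h ` carrier X = carrier Y)"

definition finitely_generated :: "('f, 'r) signature \<Rightarrow> ('u, 'f, 'r) fo_struct \<Rightarrow> bool" where
  "finitely_generated L M \<longleftrightarrow> is_structure L M \<and>
     (\<exists>S. finite S \<and> S \<subseteq> carrier M \<and>
        (\<forall>N. substructure L N M \<and> S \<subseteq> carrier N \<longrightarrow> N = M))"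

definition iso_closed :: "('f, 'r) signature \<Rightarrow> ('u, 'f, 'r) fo_struct set \<Rightarrow> bool" where
  "iso_closed L F \<longleftrightarrow> (\<forall>X\<in>F. \<forall>Y. isomorphic L X Y \<longrightarrow> Y \<in> F)"

text \<open>
  A class of countable structures is represented by its members with carrier contained in a
  type \<open>'u\<close>. This loses nothing as long as \<open>'u\<close> is uncountable: every countable structure then
  has an isomorphic copy in \<open>'u\<close>, there is always room for countable extensions, and unions of
  countable chains of countable structures stay within \<open>'u\<close>.
\<close>

definition structure_class :: "('f, 'r) signature \<Rightarrow> ('u, 'f, 'r) fo_struct set \<Rightarrow> bool" where
  "structure_class L F \<longleftrightarrow>
     (\<forall>X\<in>F. countable (carrier X) \<and> finitely_generated L X) \<and> iso_closed L F"

text \<open>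
  The union of a chain is the structure on the union of the carriers that extends every member
  of the chain; these conditions determine it.
\<close>

definition sigma_class ::
  "('f, 'r) signature \<Rightarrow> ('u, 'f, 'r) fo_struct set \<Rightarrow> ('u, 'f, 'r) fo_struct set" where
  "sigma_class L F = {G. \<exists>X :: nat \<Rightarrow> ('u, 'f, 'r) fo_struct.
     (\<forall>n. X n \<in> F) \<and> (\<forall>n. substructure L (X n) (X (Suc n))) \<and>
     carrier G = (\<Union>n. carrier (X n)) \<and> (\<forall>n. substructure L (X n) G)}"

definition Age ::
  "('f, 'r) signature \<Rightarrow> ('u, 'f, 'r) fo_struct \<Rightarrow> ('u, 'f, 'r) fo_struct set" where
  "Age L G = {X. finitely_generated L X \<and> embeds L X G}"

definition cofinal_in ::
  "('f, 'r) signature \<Rightarrow> ('u, 'f, 'r) fo_struct set \<Rightarrow> ('u, 'f, 'r) fo_struct set \<Rightarrow> bool" where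
  "cofinal_in L F' F \<longleftrightarrow> F' \<subseteq> F \<and> (\<forall>X\<in>F. \<exists>Y\<in>F'. substructure L X Y)"

definition JEP :: "('f, 'r) signature \<Rightarrow> ('u, 'f, 'r) fo_struct set \<Rightarrow> bool" where
  "JEP L F \<longleftrightarrow> (\<forall>X\<in>F. \<forall>Y\<in>F. \<exists>Z\<in>F. embeds L X Z \<and> embeds L Y Z)"

definition WAP :: "('f, 'r) signature \<Rightarrow> ('u, 'f, 'r) fo_struct set \<Rightarrow> bool" where
  "WAP L F \<longleftrightarrow> (\<forall>Z\<in>F. \<exists>Z'\<in>F. substructure L Z Z' \<and>
     (\<forall>X\<in>F. \<forall>Y\<in>F. \<forall>f g. embedding L f Z' X \<and> embedding L g Z' Y \<longrightarrow>
        (\<exists>V\<in>F. \<exists>f' g'. embedding L f' X V \<and> embedding L g' Y V \<and>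
           (\<forall>z\<in>carrier Z. f' (f z) = g' (g z)))))"

definition countably_many_iso_types ::
  "('f, 'r) signature \<Rightarrow> ('u, 'f, 'r) fo_struct set \<Rightarrow> bool" where
  "countably_many_iso_types L F \<longleftrightarrow>
     countable (F // {(X, Y). X \<in> F \<and> Y \<in> F \<and> isomorphic L X Y})"

definition weak_Fraisse_class :: "('f, 'r) signature \<Rightarrow> ('u, 'f, 'r) fo_struct set \<Rightarrow> bool" where
  "weak_Fraisse_class L F \<longleftrightarrow>
     structure_class L F \<and> JEP L F \<and> WAP L F \<and> countably_many_iso_types L F"

definition weakly_injective_for ::
  "('f, 'r) signature \<Rightarrow> ('u, 'f, 'r) fo_struct set \<Rightarrow> ('u, 'f, 'r) fo_struct \<Rightarrow> bool" where
  "weakly_injective_for L F G \<longleftrightarrow> G \<in> sigma_class L F \<and> (\<forall>X\<in>F. embeds L X G) \<and>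
     (\<forall>A\<in>F. substructure L A G \<longrightarrow>
        (\<exists>B\<in>F. substructure L A B \<and> substructure L B G \<and>
           (\<forall>X\<in>F. substructure L B X \<longrightarrow>
              (\<exists>f. embedding L f X G \<and> (\<forall>a\<in>carrier A. f a = a)))))"

definition weakly_injective :: "('f, 'r) signature \<Rightarrow> ('u, 'f, 'r) fo_struct \<Rightarrow> bool" where
  "weakly_injective L G \<longleftrightarrow> weakly_injective_for L (Age L G) G"

end

theory Submission
  imports Defs
begin

text \<open>
  Existence: let \<open>W X\<close> be a WAP witness for \<open>X\<close> and build a chain with
  \<open>X\<^sub>n \<le> W X\<^sub>n \<le> X\<^sub>n\<^sub>+\<^sub>1\<close> such that every extension of \<open>W X\<^sub>n\<close> in the class maps into
  some later \<open>X\<^sub>k\<close> over \<open>X\<^sub>n\<close>; weak amalgamation makes each single requirement achievable, and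
  there are only countably many of them because an embedding is determined by the images of
  finitely many generators. The union of the chain is the required structure. Uniqueness is a
  back-and-forth argument with embeddings \<open>q: B \<rightarrow> H\<close> for \<open>A \<le> B \<le> G\<close>, of which only the
  restriction to \<open>A\<close> is retained in the next step. For the converse, amalgams are found inside
  \<open>G\<close>, and isomorphism types are counted by finite generating subsets of \<open>G\<close>.
\<close>

section \<open>Substructures, embeddings and isomorphisms\<close>

lemma tuples_mono: "A \<subseteq> B \<Longrightarrow> tuples n A \<subseteq> tuples n B"
  by (auto simp: tuples_def)

lemma map_in_tuples: "xs \<in> tuples n A \<Longrightarrow> h ` A \<subseteq> B \<Longrightarrow> map h xs \<in> tuples n B"
  by (auto simp: tuples_def)

lemma fun_int_closed:
  "is_structure L M \<Longrightarrow> f \<in> fun_syms L \<Longrightarrow> xs \<in> tuples (fun_arity L f) (carrier M) \<Longrightarrow>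
   fun_int M f xs \<in> carrier M"
  by (simp add: is_structure_def)

text \<open>Lets facts about embeddings serve for substructures: transitivity, restriction and
  enlargement of the codomain become compositions with the identity.\<close>

lemma substructure_iff_embedding: "substructure L X Y \<longleftrightarrow> embedding L (\<lambda>x. x) X Y"
  by (auto simp: substructure_def embedding_def)

lemma substructure_refl: "is_structure L X \<Longrightarrow> substructure L X X"
  by (simp add: substructure_def)

lemma embedding_image_subset: "embedding L h X Y \<Longrightarrow> h ` carrier X \<subseteq> carrier Y"
  by (simp add: embedding_def)

lemma embedding_compose:
  assumes f: "embedding L f X Y" and g: "embedding L g Y Z"
  shows "embedding L (\<lambda>x. g (f x)) X Z"
proof -
  have im: "f ` carrier X \<subseteq> carrier Y" using f by (simp add: embedding_def)
  have "inj_on (\<lambda>x. g (f x)) (carrier X)"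
    using f g im comp_inj_on[of f "carrier X" g] inj_on_subset[of g "carrier Y"]
    by (simp add: embedding_def comp_def)
  moreover have "map f xs \<in> tuples n (carrier Y)" if "xs \<in> tuples n (carrier X)" for xs n
    using that im by (rule map_in_tuples)
  moreover have "(\<lambda>x. g (f x)) ` carrier X \<subseteq> carrier Z"
    using f g by (fastforce simp: embedding_def)
  ultimately show ?thesis
    using f g by (auto simp: embedding_def comp_def)
qed

lemma substructure_trans: "substructure L X Y \<Longrightarrow> substructure L Y Z \<Longrightarrow> substructure L X Z"
  using embedding_compose[of L "\<lambda>x. x" X Y "\<lambda>x. x" Z] by (simp add: substructure_iff_embedding)

lemma embedding_substructure:
  "embedding L f X Y \<Longrightarrow> substructure L Y Z \<Longrightarrow> embedding L f X Z"
  using embedding_compose[of L f X Y "\<lambda>x. x" Z] by (simp add: substructure_iff_embedding)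

lemma embedding_restrict:
  "substructure L X Y \<Longrightarrow> embedding L f Y Z \<Longrightarrow> embedding L f X Z"
  using embedding_compose[of L "\<lambda>x. x" X Y f Z] by (simp add: substructure_iff_embedding)

lemma embedding_cong:
  assumes "embedding L f X Y" and eq: "\<And>x. x \<in> carrier X \<Longrightarrow> f x = g x"
  shows "embedding L g X Y"
proof -
  have m: "map g xs = map f xs" if "xs \<in> tuples n (carrier X)" for xs n
    using that eq by (auto simp: tuples_def)
  have "inj_on g (carrier X)" "g ` carrier X \<subseteq> carrier Y"
    using assms inj_on_cong[of "carrier X" f g] by (auto simp: embedding_def)
  moreover have "g (fun_int X s xs) = f (fun_int X s xs)"
    if "s \<in> fun_syms L" "xs \<in> tuples (fun_arity L s) (carrier X)" for s xs
    using that assms(1) eq[symmetric] fun_int_closed by (metis embedding_def)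
  ultimately show ?thesis
    using assms(1) m by (auto simp: embedding_def simp del: map_eq_conv)
qed

lemma embedding_inv_into:
  assumes h: "embedding L h X Y" and onto: "h ` carrier X = carrier Y"
  shows "embedding L (inv_into (carrier X) h) Y X"
proof -
  let ?k = "inv_into (carrier X) h"
  have inj: "inj_on h (carrier X)" using h by (simp add: embedding_def)
  have im: "?k ` carrier Y = carrier X"
    using inj onto by (metis inv_into_image_cancel order_refl)
  have tup: "map ?k ys \<in> tuples n (carrier X)" if "ys \<in> tuples n (carrier Y)" for ys n
    using that im by (auto intro: map_in_tuples)
  have cancel: "map h (map ?k ys) = ys" if "ys \<in> tuples n (carrier Y)" for ys n
    using that onto by (auto simp: tuples_def f_inv_into_f intro!: map_idI)
  have "?k (fun_int Y s ys) = fun_int X s (map ?k ys)"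
    if "s \<in> fun_syms L" "ys \<in> tuples (fun_arity L s) (carrier Y)" for s ys
  proof -
    have "h (fun_int X s (map ?k ys)) = fun_int Y s ys"
      using h that tup cancel by (metis (no_types, lifting) embedding_def)
    moreover have "fun_int X s (map ?k ys) \<in> carrier X"
      using h that tup fun_int_closed by (metis embedding_def)
    ultimately show ?thesis using inj by (metis inv_into_f_f)
  qed
  moreover have "rel_int Y s ys = rel_int X s (map ?k ys)"
    if "s \<in> rel_syms L" "ys \<in> tuples (rel_arity L s) (carrier Y)" for s ys
    using h that tup cancel by (metis (no_types, lifting) embedding_def)
  moreover have "inj_on ?k (carrier Y)"
    using onto by (simp add: inj_on_inv_into)
  ultimately show ?thesis
    using h im by (auto simp: embedding_def)
qed

lemma isomorphic_refl: "is_structure L X \<Longrightarrow> isomorphic L X X"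
  unfolding isomorphic_def
  by (rule exI[of _ "\<lambda>x. x"]) (simp add: substructure_refl flip: substructure_iff_embedding)

lemma isomorphic_sym: "isomorphic L X Y \<Longrightarrow> isomorphic L Y X"
  unfolding isomorphic_def
  by (metis embedding_def embedding_inv_into inv_into_image_cancel order_refl)

lemma isomorphic_trans:
  assumes "isomorphic L X Y" "isomorphic L Y Z"
  shows "isomorphic L X Z"
proof -
  obtain f g where "embedding L f X Y" "f ` carrier X = carrier Y"
    "embedding L g Y Z" "g ` carrier Y = carrier Z"
    using assms by (auto simp: isomorphic_def)
  then show ?thesis
    using embedding_compose[of L f X Y g Z] unfolding isomorphic_def by (metis image_image)
qed

text \<open>On \<open>carrier A\<close>, \<open>k\<close> agrees with the inverse of the isomorphism
  \<open>h\<close> followed by \<open>g\<close>.\<close>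

lemma embedding_factor:
  assumes h: "embedding L h X A" "h ` carrier X = carrier A"
    and g: "embedding L g X G" and eq: "\<And>x. x \<in> carrier X \<Longrightarrow> k (h x) = g x"
  shows "embedding L k A G"
proof (rule embedding_cong)
  show "embedding L (\<lambda>y. g (inv_into (carrier X) h y)) A G"
    using embedding_compose[OF embedding_inv_into[OF h] g] .
  show "g (inv_into (carrier X) h y) = k y" if "y \<in> carrier A" for y
    using that h eq by (metis f_inv_into_f inv_into_into)
qed

text \<open>Outside the tuples over the common carrier, both interpretations take the default values
  prescribed by \<open>is_structure\<close>.\<close>

lemma substructure_eqI:
  assumes "substructure L X Y" "carrier X = carrier Y"
  shows "X = Y"
proof (rule fo_struct.equality)
  show "fun_int X = fun_int Y"
    using assms by (intro ext) (metis is_structure_def substructure_def)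
  show "rel_int X = rel_int Y"
    using assms by (intro ext) (metis is_structure_def substructure_def)
qed (use assms in auto)

section \<open>Transport of structure along injections\<close>

definition image_struct ::
  "('f, 'r) signature \<Rightarrow> ('u \<Rightarrow> 'v) \<Rightarrow> ('u, 'f, 'r) fo_struct \<Rightarrow> ('v, 'f, 'r) fo_struct" where
  "image_struct L h M = \<lparr>carrier = h ` carrier M,
     fun_int = (\<lambda>f ys. if f \<in> fun_syms L \<and> ys \<in> tuples (fun_arity L f) (h ` carrier M)
        then h (fun_int M f (map (inv_into (carrier M) h) ys)) else undefined),
     rel_int = (\<lambda>r ys. r \<in> rel_syms L \<and> ys \<in> tuples (rel_arity L r) (h ` carrier M) \<and>
        rel_int M r (map (inv_into (carrier M) h) ys))\<rparr>"

lemma carrier_image_struct [simp]: "carrier (image_struct L h M) = h ` carrier M"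
  by (simp add: image_struct_def)

lemma embedding_image_struct:
  assumes M: "is_structure L M" and inj: "inj_on h (carrier M)"
  shows "embedding L h M (image_struct L h M)"
proof -
  let ?k = "inv_into (carrier M) h"
  have tup: "map ?k ys \<in> tuples n (carrier M)" if "ys \<in> tuples n (h ` carrier M)" for ys n
    using that inj by (auto intro: map_in_tuples)
  have st: "is_structure L (image_struct L h M)"
    using fun_int_closed[OF M] tup by (auto simp: is_structure_def image_struct_def)
  have cancel: "map ?k (map h xs) = xs" if "xs \<in> tuples n (carrier M)" for xs n
    using that inj by (auto simp: tuples_def intro!: map_idI)
  have fwd: "map h xs \<in> tuples n (h ` carrier M)" if "xs \<in> tuples n (carrier M)" for xs n
    using that by (auto intro: map_in_tuples)
  show ?thesis
    using M inj st fwd cancel unfolding embedding_def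
    by (auto simp: image_struct_def simp del: map_map)
qed

text \<open>Splits an embedding into an isomorphism and an inclusion, so that closure under
  isomorphism applies to the image.\<close>

lemma embedding_image:
  assumes "embedding L h X G"
  obtains A where "substructure L A G" "embedding L h X A" "h ` carrier X = carrier A"
proof
  have h: "embedding L h X (image_struct L h X)"
    using assms by (intro embedding_image_struct) (auto simp: embedding_def)
  then show "embedding L h X (image_struct L h X)" .
  show "substructure L (image_struct L h X) G"
    unfolding substructure_iff_embedding by (rule embedding_factor[OF h _ assms]) auto
qed simp

text \<open>Turns an extension up to embedding into a genuine superstructure. Points in the image of
  \<open>e\<close> get their old names back; the other, countably many points of \<open>Y\<close>
  receive fresh names outside \<open>carrier X\<close>, which exist because \<open>'u\<close> is
  uncountable.\<close>

lemma exists_copy_above: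
  fixes X Y :: "('u, 'f, 'r) fo_struct"
  assumes U: "uncountable (UNIV :: 'u set)" and e: "embedding L e X Y"
    and Y: "countable (carrier Y)"
  shows "\<exists>Y' h. embedding L h Y Y' \<and> h ` carrier Y = carrier Y' \<and> substructure L X Y' \<and>
    (\<forall>x\<in>carrier X. h (e x) = x)"
proof -
  have inj: "inj_on e (carrier X)" and im: "e ` carrier X \<subseteq> carrier Y"
    using e by (auto simp: embedding_def)
  have "countable (carrier X)"
    using inj im Y by (metis countable_image_inj_on countable_subset)
  then have "infinite (UNIV - carrier X)"
    using U by (metis uncountable_infinite uncountable_minus_countable)
  then obtain f :: "nat \<Rightarrow> 'u" where f: "inj f" "range f \<subseteq> UNIV - carrier X"
    by (meson infinite_countable_subset)
  define j where "j = f \<circ> to_nat_on (carrier Y - e ` carrier X)"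
  have j: "inj_on j (carrier Y - e ` carrier X)"
    "j ` (carrier Y - e ` carrier X) \<subseteq> UNIV - carrier X"
    using f Y by (auto simp: j_def intro!: comp_inj_on inj_on_to_nat_on intro: inj_on_subset)
  define h where "h y = (if y \<in> e ` carrier X then inv_into (carrier X) e y else j y)" for y
  have he: "h (e x) = x" if "x \<in> carrier X" for x
    using that inj by (simp add: h_def)
  have "inj_on h (e ` carrier X \<union> (carrier Y - e ` carrier X))"
    unfolding inj_on_Un
  proof (intro conjI)
    show "inj_on h (e ` carrier X)"
      using he by (auto simp: inj_on_def)
    show "inj_on h (carrier Y - e ` carrier X)"
      using j(1) by (auto simp: inj_on_def h_def)
    show "h ` (e ` carrier X - (carrier Y - e ` carrier X)) \<inter>
        h ` (carrier Y - e ` carrier X - e ` carrier X) = {}"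
      using j(2) he by (fastforce simp: h_def)
  qed
  then have "inj_on h (carrier Y)"
    using im by (simp add: Un_absorb1)
  then have h: "embedding L h Y (image_struct L h Y)"
    using e by (intro embedding_image_struct) (auto simp: embedding_def)
  have "substructure L X (image_struct L h Y)"
    unfolding substructure_iff_embedding
    by (rule embedding_cong[OF embedding_compose[OF e h]]) (simp add: he)
  then show ?thesis using h he by (intro exI[of _ "image_struct L h Y"] exI[of _ h]) simp
qed

section \<open>Generating sets and maps determined by generators\<close>

definition generates :: "('f, 'r) signature \<Rightarrow> 'u set \<Rightarrow> ('u, 'f, 'r) fo_struct \<Rightarrow> bool" where
  "generates L S M \<longleftrightarrow> is_structure L M \<and> S \<subseteq> carrier M \<and>
     (\<forall>N. substructure L N M \<and> S \<subseteq> carrier N \<longrightarrow> N = M)"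

lemma finitely_generated_iff: "finitely_generated L M \<longleftrightarrow> (\<exists>S. finite S \<and> generates L S M)"
  by (auto simp: finitely_generated_def generates_def)

text \<open>The elements satisfying \<open>P\<close> contain \<open>S\<close> and are closed under
  the operations, so they carry a substructure, which minimality forces to be
  \<open>M\<close>.\<close>

lemma generates_induct:
  assumes gen: "generates L S M" and S: "\<And>x. x \<in> S \<Longrightarrow> P x"
    and step: "\<And>f xs. f \<in> fun_syms L \<Longrightarrow> xs \<in> tuples (fun_arity L f) (carrier M) \<Longrightarrow>
      (\<And>x. x \<in> set xs \<Longrightarrow> P x) \<Longrightarrow> P (fun_int M f xs)"
    and x: "x \<in> carrier M"
  shows "P x"
proof -
  let ?C = "{x \<in> carrier M. P x}"
  define N where "N = \<lparr>carrier = ?C,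
    fun_int = (\<lambda>f xs. if f \<in> fun_syms L \<and> xs \<in> tuples (fun_arity L f) ?C
       then fun_int M f xs else undefined),
    rel_int = (\<lambda>r xs. r \<in> rel_syms L \<and> xs \<in> tuples (rel_arity L r) ?C \<and> rel_int M r xs)\<rparr>"
  have M: "is_structure L M" using gen by (simp add: generates_def)
  have "fun_int M f xs \<in> ?C" if "f \<in> fun_syms L" "xs \<in> tuples (fun_arity L f) ?C" for f xs
    using that step[of f xs] fun_int_closed[OF M, of f xs] by (auto simp: tuples_def subset_iff)
  then have "is_structure L N"
    by (auto simp: is_structure_def N_def)
  then have "substructure L N M"
    using M by (auto simp: substructure_def N_def)
  moreover have "S \<subseteq> carrier N"
    using gen S by (auto simp: N_def generates_def)
  ultimately have "N = M" using gen by (simp add: generates_def)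
  from arg_cong[OF this, of carrier] have "carrier M = ?C" by (simp add: N_def)
  then show ?thesis using x by blast
qed

lemma generates_image:
  assumes gen: "generates L S X" and h: "embedding L h X Y" and onto: "h ` carrier X = carrier Y"
  shows "generates L (h ` S) Y"
  unfolding generates_def
proof (intro conjI allI impI)
  show "is_structure L Y" using h by (simp add: embedding_def)
  show "h ` S \<subseteq> carrier Y" using gen onto by (auto simp: generates_def)
  fix N assume N: "substructure L N Y \<and> h ` S \<subseteq> carrier N"
  have mem: "h x \<in> carrier N" if "x \<in> carrier X" for x
    using gen _ _ that
  proof (rule generates_induct)
    fix f xs assume f: "f \<in> fun_syms L" and xs: "xs \<in> tuples (fun_arity L f) (carrier X)"
      and IH: "\<And>x. x \<in> set xs \<Longrightarrow> h x \<in> carrier N"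
    have "map h xs \<in> tuples (fun_arity L f) (carrier N)"
      using xs IH by (auto simp: tuples_def)
    then have "fun_int Y f (map h xs) \<in> carrier N"
      using N f fun_int_closed by (metis substructure_def)
    then show "h (fun_int X f xs) \<in> carrier N"
      using h f xs by (simp add: embedding_def)
  qed (use N in auto)
  then have "carrier N = carrier Y"
    using N onto mem by (metis image_subset_iff subset_antisym substructure_def)
  then show "N = Y" using N substructure_eqI by blast
qed

lemma finitely_generated_isomorphic:
  "finitely_generated L X \<Longrightarrow> isomorphic L X Y \<Longrightarrow> finitely_generated L Y"
  unfolding finitely_generated_iff isomorphic_def by (metis finite_imageI generates_image)

text \<open>By induction on generation, all of the image lies in \<open>C\<close> once the
  generators do. Hence a finitely generated structure that maps into the union of a chain maps into
  one member.\<close>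

lemma embedding_into_substructure:
  assumes gen: "generates L S X" and u: "embedding L u X G" and C: "substructure L C G"
    and S: "u ` S \<subseteq> carrier C"
  shows "embedding L u X C"
proof -
  have mem: "u x \<in> carrier C" if "x \<in> carrier X" for x
    using gen _ _ that
  proof (rule generates_induct)
    fix f xs assume f: "f \<in> fun_syms L" and xs: "xs \<in> tuples (fun_arity L f) (carrier X)"
      and IH: "\<And>x. x \<in> set xs \<Longrightarrow> u x \<in> carrier C"
    have t: "map u xs \<in> tuples (fun_arity L f) (carrier C)"
      using xs IH by (auto simp: tuples_def)
    then have "fun_int C f (map u xs) \<in> carrier C"
      using C f fun_int_closed by (metis substructure_def)
    then show "u (fun_int X f xs) \<in> carrier C"
      using C u f xs t by (simp add: embedding_def substructure_def)
  qed (use S in auto)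
  then have "map u xs \<in> tuples n (carrier C)" if "xs \<in> tuples n (carrier X)" for xs n
    using that by (auto intro: map_in_tuples)
  then show ?thesis
    using mem u C by (auto simp: embedding_def substructure_def)
qed

text \<open>Allows an embedding of a finitely generated structure to be coded by the finite list of
  images of generators.\<close>

lemma embeddings_eq_on_generators:
  assumes gen: "generates L S X" and f: "embedding L f X Y" and g: "embedding L g X Y"
    and S: "\<And>x. x \<in> S \<Longrightarrow> f x = g x" and x: "x \<in> carrier X"
  shows "f x = g x"
  using gen S _ x
proof (rule generates_induct)
  fix s xs assume "s \<in> fun_syms L" "xs \<in> tuples (fun_arity L s) (carrier X)"
    and "\<And>x. x \<in> set xs \<Longrightarrow> f x = g x"
  moreover from this(3) have "map f xs = map g xs" by simp
  ultimately show "f (fun_int X s xs) = g (fun_int X s xs)"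
    using f g unfolding embedding_def by metis
qed

section \<open>Unions of increasing chains\<close>

lemma chain_substructure:
  assumes "\<And>n. substructure L (X n) (X (Suc n))" "m \<le> n"
  shows "substructure L (X m) (X n)"
  using \<open>m \<le> n\<close>
proof (induction n rule: dec_induct)
  case base
  show ?case using assms(1)[of m] by (simp add: substructure_def)
qed (use assms(1) substructure_trans in blast)

lemma finite_subset_chain:
  assumes "\<And>n. substructure L (X n) (X (Suc n))" "finite E" "E \<subseteq> (\<Union>n. carrier (X n))"
  shows "\<exists>n. E \<subseteq> carrier (X n)"
  using assms(2,3)
proof (induction E rule: finite_induct)
  case (insert x E)
  then obtain m n where "E \<subseteq> carrier (X m)" "x \<in> carrier (X n)" by auto
  moreover have "carrier (X m) \<subseteq> carrier (X (max m n))" "carrier (X n) \<subseteq> carrier (X (max m n))"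
    using chain_substructure[of L X, OF assms(1)] by (auto simp: substructure_def)
  ultimately show ?case by blast
qed simp

text \<open>A tuple, being finite, lies in a single stage; the least such stage is a canonical place
  to evaluate it.\<close>

definition chain_union ::
  "('f, 'r) signature \<Rightarrow> (nat \<Rightarrow> ('u, 'f, 'r) fo_struct) \<Rightarrow> ('u, 'f, 'r) fo_struct" where
  "chain_union L X = (let C = \<Union>n. carrier (X n) in \<lparr>carrier = C,
     fun_int = (\<lambda>f xs. if f \<in> fun_syms L \<and> xs \<in> tuples (fun_arity L f) C
        then fun_int (X (LEAST n. set xs \<subseteq> carrier (X n))) f xs else undefined),
     rel_int = (\<lambda>r xs. r \<in> rel_syms L \<and> xs \<in> tuples (rel_arity L r) C \<and>
        rel_int (X (LEAST n. set xs \<subseteq> carrier (X n))) r xs)\<rparr>)"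

lemma carrier_chain_union [simp]: "carrier (chain_union L X) = (\<Union>n. carrier (X n))"
  by (simp add: chain_union_def Let_def)

lemma substructure_chain_union:
  assumes ch: "\<And>n. substructure L (X n) (X (Suc n))"
  shows "substructure L (X n) (chain_union L X)"
proof -
  have st: "is_structure L (X n)" for n using ch by (simp add: substructure_def)
  have ex: "set xs \<subseteq> carrier (X (LEAST n. set xs \<subseteq> carrier (X n)))"
    if "set xs \<subseteq> (\<Union>n. carrier (X n))" for xs
    by (rule LeastI_ex[of "\<lambda>n. set xs \<subseteq> carrier (X n)"])
      (use finite_subset_chain[of L X "set xs", OF ch] that in blast)
  have "is_structure L (chain_union L X)"
    using ex fun_int_closed[OF st]
    by (fastforce simp: is_structure_def chain_union_def Let_def tuples_def)
  \<comment> \<open>The least stage containing the tuple comes no later than \<open>n\<close>, so it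
    is a substructure of \<open>X n\<close> and both evaluate the tuple alike.\<close>
  moreover have least: "set xs \<subseteq> carrier (X (LEAST n. set xs \<subseteq> carrier (X n)))"
      "substructure L (X (LEAST n. set xs \<subseteq> carrier (X n))) (X n)"
    if "set xs \<subseteq> carrier (X n)" for xs
    using that chain_substructure[of L X, OF ch]
      LeastI[of "\<lambda>n. set xs \<subseteq> carrier (X n)" n] Least_le[of "\<lambda>n. set xs \<subseteq> carrier (X n)" n]
    by blast+
  moreover have "tuples k (carrier (X n)) \<subseteq> tuples k (\<Union>n. carrier (X n))" for k
    by (auto intro!: tuples_mono)
  ultimately show ?thesis
    using st unfolding substructure_def
    by (auto simp: chain_union_def Let_def tuples_def)
qed

lemma sigma_class_finite_subset:
  assumes "G \<in> sigma_class L F" "finite E" "E \<subseteq> carrier G"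
  shows "\<exists>C\<in>F. substructure L C G \<and> E \<subseteq> carrier C"
  using assms finite_subset_chain unfolding sigma_class_def mem_Collect_eq by metis

text \<open>The images of two finite generating sets together form a finite subset of
  \<open>G\<close>, so one member of the chain contains them.\<close>

lemma sigma_class_common_target:
  assumes G: "G \<in> sigma_class L F" and X: "finitely_generated L X" "embedding L u X G"
    and Y: "finitely_generated L Y" "embedding L v Y G"
  shows "\<exists>C\<in>F. substructure L C G \<and> embedding L u X C \<and> embedding L v Y C"
proof -
  obtain S T where S: "finite S" "generates L S X" and T: "finite T" "generates L T Y"
    using X(1) Y(1) by (auto simp: finitely_generated_iff)
  have "u ` S \<union> v ` T \<subseteq> carrier G"
    using S(2) T(2) embedding_image_subset[OF X(2)] embedding_image_subset[OF Y(2)]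
    by (metis Un_least generates_def image_mono order_trans)
  then obtain C where "C \<in> F" "substructure L C G" "u ` S \<union> v ` T \<subseteq> carrier C"
    using sigma_class_finite_subset[OF G, of "u ` S \<union> v ` T"] S T by auto
  then show ?thesis
    using embedding_into_substructure S T X Y by (metis le_sup_iff)
qed

lemma substructure_common_target:
  assumes "generates L S A" "substructure L A G" "substructure L C G" "S \<subseteq> carrier C"
  shows "substructure L A C"
  using embedding_into_substructure[of L S A "\<lambda>x. x" G C] assms
  by (simp add: substructure_iff_embedding)

text \<open>
  Stage \<open>Suc m\<close> of the chain deals with task number \<open>j\<close> of stage \<open>i\<close>, where \<open>(i, j)\<close>
  is the pair coded by \<open>m\<close>.
\<close>

lemma exists_chain_meeting_tasks:
  fixes R :: "'a \<Rightarrow> 'a \<Rightarrow> bool"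
  assumes x0: "x0 \<in> S"
    and trans: "\<And>x y z. R x y \<Longrightarrow> R y z \<Longrightarrow> R x z"
    and cnt: "\<And>x. x \<in> S \<Longrightarrow> countable (T x)"
    and ext: "\<And>x. x \<in> S \<Longrightarrow> \<exists>y\<in>S. R x y"
    and step: "\<And>x y t. x \<in> S \<Longrightarrow> y \<in> S \<Longrightarrow> x = y \<or> R x y \<Longrightarrow> t \<in> T x \<Longrightarrow>
      \<exists>z\<in>S. R y z \<and> Q x t z"
  shows "\<exists>X. (\<forall>n. X n \<in> S \<and> R (X n) (X (Suc n))) \<and> (\<forall>n. \<forall>t\<in>T (X n). \<exists>k>n. Q (X n) t (X k))"
proof -
  \<comment> \<open>\<open>P f n z\<close> admits \<open>z\<close> as stage \<open>n\<close> after
    the earlier values of \<open>f\<close>. At \<open>n = 0\<close> only membership in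
    \<open>S\<close> is asked; the guard on \<open>T (f i)\<close> excludes the arbitrary value of
    \<open>from_nat_into\<close> on the empty set.\<close>
  define P where "P f n z \<longleftrightarrow> z \<in> S \<and> (\<forall>m i j. n = Suc m \<and> (i, j) = prod_decode m \<longrightarrow>
    R (f m) z \<and> (T (f i) \<noteq> {} \<longrightarrow> Q (f i) (from_nat_into (T (f i)) j) z))"
    for f :: "nat \<Rightarrow> 'a" and n z
  \<comment> \<open>The stage whose task is due at \<open>Suc m\<close> has already been
    built.\<close>
  have le: "i \<le> m" if "(i, j) = prod_decode m" for i j m
    using le_prod_encode_1[of i j] that by simp
  have R: "X i = X m \<or> R (X i) (X m)" if "\<And>k. k < m \<Longrightarrow> R (X k) (X (Suc k))" "i \<le> m"
    for X :: "nat \<Rightarrow> 'a" and i m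
    using \<open>i \<le> m\<close> that(1)
  proof (induction m rule: dec_induct)
    case (step m)
    then show ?case by (metis lessI less_SucI trans)
  qed simp
  have "\<exists>X. \<forall>n. P X n (X n)"
  proof (rule dependent_wf_choice[OF wf_less_than])
    fix f g :: "nat \<Rightarrow> 'a" and n z
    assume eq: "\<And>m. (m, n) \<in> less_than \<Longrightarrow> f m = g m"
    \<comment> \<open>Dependent choice needs \<open>P\<close> to consult only values below
      \<open>n\<close>; it looks at \<open>m\<close> and \<open>i\<close>, and
      \<open>i \<le> m < n\<close>.\<close>
    have "f m = g m \<and> f i = g i" if "n = Suc m" "(i, j) = prod_decode m" for m i j
      using that le[of i j m] by (auto intro!: eq)
    then show "P f n z = P g n z" unfolding P_def by metis
  next
    fix n f assume "\<And>m. (m, n) \<in> less_than \<Longrightarrow> P f m (f m)"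
    then have IH: "P f m (f m)" if "m < n" for m using that by simp
    show "\<exists>z. P f n z"
    proof (cases n)
      case 0
      then show ?thesis using x0 by (auto simp: P_def)
    next
      case (Suc m)
      obtain i j where ij: "(i, j) = prod_decode m" by (metis surj_pair)
      have fS: "f k \<in> S" if "k \<le> m" for k using IH[of k] that Suc by (simp add: P_def)
      have "R (f k) (f (Suc k))" if "k < m" for k
        using IH[of "Suc k"] that Suc unfolding P_def by (metis Suc_mono surj_pair)
      then have "f i = f m \<or> R (f i) (f m)" using R le[OF ij] by blast
      \<comment> \<open>If there is no task to meet, \<open>ext\<close> supplies the next stage;
        otherwise \<open>step\<close> does.\<close>
      then have "\<exists>z\<in>S. R (f m) z \<and> (T (f i) \<noteq> {} \<longrightarrow> Q (f i) (from_nat_into (T (f i)) j) z)"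
        using step[of "f i" "f m" "from_nat_into (T (f i)) j"] ext[of "f m"] fS le[OF ij]
        by (metis from_nat_into le_refl)
      then show ?thesis using Suc unfolding P_def by (metis Pair_inject Suc_inject ij)
    qed
  qed
  then obtain X where X: "\<And>n. P X n (X n)" by blast
  have XS: "X n \<in> S" for n using X[of n] by (simp add: P_def)
  have XR: "R (X n) (X (Suc n))" for n using X[of "Suc n"] unfolding P_def by (metis surj_pair)
  have "\<exists>k>n. Q (X n) t (X k)" if t: "t \<in> T (X n)" for n t
  proof -
    obtain j where j: "from_nat_into (T (X n)) j = t"
      using from_nat_into_surj[OF cnt[OF XS] t] by blast
    define m where "m = prod_encode (n, j)"
    have "Q (X n) t (X (Suc m))"
      using X[of "Suc m"] t j unfolding P_def m_def by (metis empty_iff prod_encode_inverse)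
    moreover have "n < Suc m" using le_prod_encode_1[of n j] by (simp add: m_def)
    ultimately show ?thesis by blast
  qed
  then show ?thesis using XS XR by blast
qed

text \<open>Each condition on \<open>h\<close> concerns finitely many points, so it can be checked
  in one member of the chain.\<close>

lemma embedding_from_chain_union:
  assumes ch: "\<And>n. substructure L (X n) (X (Suc n))" and G: "\<And>n. substructure L (X n) G"
    and cG: "carrier G = (\<Union>n. carrier (X n))" and h: "\<And>n. embedding L h (X n) H"
  shows "embedding L h G H"
proof -
  have loc: "\<exists>n. set xs \<subseteq> carrier (X n)" if "set xs \<subseteq> carrier G" for xs
    using finite_subset_chain[of L X "set xs", OF ch] that cG by simp
  have "inj_on h (carrier G)"
  proof (rule inj_onI)
    fix x y assume xy: "x \<in> carrier G" "y \<in> carrier G" "h x = h y"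
    obtain n where "x \<in> carrier (X n)" "y \<in> carrier (X n)" using loc[of "[x, y]"] xy by auto
    then show "x = y" using h[of n] xy(3) by (auto simp: embedding_def inj_on_def)
  qed
  moreover have "h ` carrier G \<subseteq> carrier H"
    using embedding_image_subset[OF h] cG by auto
  moreover have "h (fun_int G f xs) = fun_int H f (map h xs)"
    if xs: "f \<in> fun_syms L" "xs \<in> tuples (fun_arity L f) (carrier G)" for f xs
  proof -
    obtain n where "set xs \<subseteq> carrier (X n)"
      using loc[of xs] xs(2) unfolding tuples_def by blast
    then have "xs \<in> tuples (fun_arity L f) (carrier (X n))"
      using xs(2) by (simp add: tuples_def)
    then show ?thesis using xs h[of n] G[of n] by (simp add: embedding_def substructure_def)
  qed
  moreover have "rel_int G r xs = rel_int H r (map h xs)"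
    if xs: "r \<in> rel_syms L" "xs \<in> tuples (rel_arity L r) (carrier G)" for r xs
  proof -
    obtain n where "set xs \<subseteq> carrier (X n)"
      using loc[of xs] xs(2) unfolding tuples_def by blast
    then have "xs \<in> tuples (rel_arity L r) (carrier (X n))"
      using xs(2) by (simp add: tuples_def)
    then show ?thesis using xs h[of n] G[of n] by (simp add: embedding_def substructure_def)
  qed
  ultimately show ?thesis
    using G[of 0] h[of 0] by (simp add: embedding_def substructure_def)
qed

lemma iso_closed_image:
  "iso_closed L F \<Longrightarrow> X \<in> F \<Longrightarrow> embedding L h X Y \<Longrightarrow> h ` carrier X = carrier Y \<Longrightarrow> Y \<in> F"
  unfolding iso_closed_def isomorphic_def by blast

subsection \<open>Uniqueness\<close>

text \<open>Makes the witness \<open>B\<close> that weak injectivity provides for \<open>A\<close>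
  explicit.\<close>

definition anchored ::
  "('f, 'r) signature \<Rightarrow> ('u, 'f, 'r) fo_struct set \<Rightarrow> ('u, 'f, 'r) fo_struct \<Rightarrow>
   ('u, 'f, 'r) fo_struct \<Rightarrow> ('u, 'f, 'r) fo_struct \<Rightarrow> bool" where
  "anchored L F G A B \<longleftrightarrow> A \<in> F \<and> B \<in> F \<and> substructure L A B \<and> substructure L B G \<and>
     (\<forall>X\<in>F. substructure L B X \<longrightarrow> (\<exists>f. embedding L f X G \<and> (\<forall>a\<in>carrier A. f a = a)))"

lemma weakly_injective_for_anchored:
  "weakly_injective_for L F G \<Longrightarrow> A \<in> F \<Longrightarrow> substructure L A G \<Longrightarrow> \<exists>B. anchored L F G A B"
  unfolding weakly_injective_for_def anchored_def by blast

text \<open>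
  Only the part of \<open>q\<close> on \<open>A\<close> is kept by later extensions; the larger domain \<open>B\<close> is what
  makes the next extension possible.
\<close>

definition extendable_map ::
  "('f, 'r) signature \<Rightarrow> ('u, 'f, 'r) fo_struct set \<Rightarrow> ('u, 'f, 'r) fo_struct \<Rightarrow>
   ('u, 'f, 'r) fo_struct \<Rightarrow> ('u \<times> 'u) set \<Rightarrow> bool" where
  "extendable_map L F G H p \<longleftrightarrow> (\<exists>A B q. anchored L F G A B \<and> embedding L q B H \<and>
     p = (\<lambda>a. (a, q a)) ` carrier A)"

text \<open>Half a round of back-and-forth. The image \<open>C\<close> of \<open>B\<close> in
  \<open>H\<close> is enlarged to \<open>C'\<close> containing \<open>E\<close> and anchored by
  \<open>D\<close>. Seen as an extension of \<open>B\<close>, \<open>D\<close> maps back to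
  \<open>G\<close> over \<open>A\<close>, which inverts \<open>q\<close> on
  \<open>A\<close>.\<close>

lemma extendable_map_switch:
  fixes F :: "('u, 'f, 'r) fo_struct set"
  assumes U: "uncountable (UNIV :: 'u set)" and F: "structure_class L F"
    and H: "weakly_injective_for L F H"
    and p: "extendable_map L F G H p" and E: "finite E" "E \<subseteq> carrier H"
  shows "\<exists>p'. extendable_map L F H G p' \<and> p\<inverse> \<subseteq> p' \<and> E \<subseteq> Domain p'"
proof -
  have iso: "iso_closed L F" using F by (simp add: structure_class_def)
  obtain A B q where AB: "anchored L F G A B" and q: "embedding L q B H"
    and p_def: "p = (\<lambda>a. (a, q a)) ` carrier A"
    using p by (auto simp: extendable_map_def)
  obtain C where C: "substructure L C H" "embedding L q B C" "q ` carrier B = carrier C"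
    using embedding_image[OF q] .
  have "C \<in> F" using iso_closed_image[OF iso _ C(2,3)] AB by (simp add: anchored_def)
  then obtain S where S: "finite S" "generates L S C"
    using F by (auto simp: structure_class_def finitely_generated_iff)
  have "E \<union> S \<subseteq> carrier H"
    using E S C(1) by (metis Un_least generates_def order_trans substructure_def)
  \<comment> \<open>Adding the generators \<open>S\<close> of \<open>C\<close> to \<open>E\<close>
    makes \<open>C'\<close> contain all of \<open>C\<close>.\<close>
  then obtain C' where C': "C' \<in> F" "substructure L C' H" "E \<union> S \<subseteq> carrier C'"
    using sigma_class_finite_subset[of H L F "E \<union> S"] H E S
    by (auto simp: weakly_injective_for_def)
  have CC': "substructure L C C'"
    using substructure_common_target[OF S(2) C(1) C'(2)] C'(3) by simp
  obtain D where D: "anchored L F H C' D"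
    using weakly_injective_for_anchored[OF H C'(1,2)] by blast
  then have "D \<in> F" "substructure L C' D" by (simp_all add: anchored_def)
  have qD: "embedding L q B D"
    using C(2) CC' \<open>substructure L C' D\<close> embedding_substructure by blast
  have cD: "countable (carrier D)" using \<open>D \<in> F\<close> F by (simp add: structure_class_def)
  \<comment> \<open>In this copy of \<open>D\<close> the map \<open>q\<close> becomes the inclusion
    of \<open>B\<close>, so the anchoring of \<open>A\<close> by \<open>B\<close> applies.\<close>
  obtain D' h where h: "embedding L h D D'" "h ` carrier D = carrier D'"
    "substructure L B D'" "\<And>x. x \<in> carrier B \<Longrightarrow> h (q x) = x"
    using exists_copy_above[OF U qD cD] by blast
  have "D' \<in> F" using iso_closed_image[OF iso \<open>D \<in> F\<close> h(1,2)] .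
  then obtain f where f: "embedding L f D' G" "\<And>a. a \<in> carrier A \<Longrightarrow> f a = a"
    using AB h(3) by (auto simp: anchored_def)
  have "extendable_map L F H G ((\<lambda>c. (c, f (h c))) ` carrier C')"
    unfolding extendable_map_def using D embedding_compose[OF h(1) f(1)] by blast
  moreover have "p\<inverse> \<subseteq> (\<lambda>c. (c, f (h c))) ` carrier C'"
  proof (clarsimp simp: p_def)
    fix a assume a: "a \<in> carrier A"
    then have aB: "a \<in> carrier B" using AB by (auto simp: anchored_def substructure_def)
    then have "q a \<in> carrier C'" using C(3) CC' by (auto simp: substructure_def)
    moreover have "f (h (q a)) = a" using a aB f(2) h(4) by simp
    ultimately show "(q a, a) \<in> (\<lambda>c. (c, f (h c))) ` carrier C'" by force
  qed
  moreover have "E \<subseteq> Domain ((\<lambda>c. (c, f (h c))) ` carrier C')"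
    using C'(3) by (auto simp: Domain_fst image_image)
  ultimately show ?thesis by blast
qed

text \<open>Two switches: the first absorbs \<open>E\<close> while reversing the direction, the
  second absorbs \<open>D\<close> and restores it.\<close>

lemma extendable_map_extend:
  fixes F :: "('u, 'f, 'r) fo_struct set"
  assumes U: "uncountable (UNIV :: 'u set)" and F: "structure_class L F"
    and G: "weakly_injective_for L F G" and H: "weakly_injective_for L F H"
    and p: "extendable_map L F G H p"
    and D: "finite D" "D \<subseteq> carrier G" and E: "finite E" "E \<subseteq> carrier H"
  shows "\<exists>p'. extendable_map L F G H p' \<and> p \<subseteq> p' \<and> D \<subseteq> Domain p' \<and> E \<subseteq> Range p'"
proof -
  obtain p1 where p1: "extendable_map L F H G p1" "p\<inverse> \<subseteq> p1" "E \<subseteq> Domain p1"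
    using extendable_map_switch[OF U F H p E] by blast
  obtain p2 where p2: "extendable_map L F G H p2" "p1\<inverse> \<subseteq> p2" "D \<subseteq> Domain p2"
    using extendable_map_switch[OF U F G p1(1) D] by blast
  have "p \<subseteq> p2"
    using p1(2) p2(2) by (metis converse_converse converse_mono order_trans)
  moreover have "E \<subseteq> Range p2"
    using p1(3) Range_mono[OF p2(2)] by (metis Range_converse order_trans)
  ultimately show ?thesis using p2 by blast
qed

text \<open>The copy in \<open>G\<close> of any member of \<open>F\<close> has an anchor, which is
  itself in \<open>F\<close> and so embeds into \<open>H\<close>.\<close>

lemma exists_extendable_map:
  assumes F: "structure_class L F" "F \<noteq> {}"
    and G: "weakly_injective_for L F G" and H: "weakly_injective_for L F H"
  shows "\<exists>p. extendable_map L F G H p"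
proof -
  obtain X e where X: "X \<in> F" "embedding L e X G"
    using F(2) G unfolding weakly_injective_for_def embeds_def by blast
  obtain A where A: "substructure L A G" "embedding L e X A" "e ` carrier X = carrier A"
    using embedding_image[OF X(2)] .
  have "A \<in> F" using iso_closed_image[OF _ X(1) A(2,3)] F by (simp add: structure_class_def)
  then obtain B where B: "anchored L F G A B"
    using weakly_injective_for_anchored[OF G _ A(1)] by blast
  then obtain q where "embedding L q B H"
    using H by (auto simp: anchored_def weakly_injective_for_def embeds_def)
  then show ?thesis using B by (auto simp: extendable_map_def)
qed

lemma countable_sigma_class:
  "structure_class L F \<Longrightarrow> G \<in> sigma_class L F \<Longrightarrow> countable (carrier G)"
  by (auto simp: structure_class_def sigma_class_def)

lemma weakly_injective_for_unique:
  fixes F :: "('u, 'f, 'r) fo_struct set"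
  assumes U: "uncountable (UNIV :: 'u set)" and F: "structure_class L F" "F \<noteq> {}"
    and G: "weakly_injective_for L F G" and H: "weakly_injective_for L F H"
  shows "isomorphic L G H"
proof -
  let ?S = "{p. extendable_map L F G H p}"
  \<comment> \<open>\<open>Inl\<close> asks for a point of \<open>G\<close> in the domain,
    \<open>Inr\<close> for a point of \<open>H\<close> in the range; the tags keep apart two
    carriers that live in the same type.\<close>
  let ?Q = "\<lambda>p t p'. case t of Inl x \<Rightarrow> x \<in> Domain p' | Inr y \<Rightarrow> y \<in> Range p'"
  obtain p0 where p0: "p0 \<in> ?S" using exists_extendable_map[OF F G H] by blast
  have cnt: "countable (carrier G <+> carrier H)"
    using countable_sigma_class[OF F(1)] G H by (simp add: weakly_injective_for_def)
  note ext = extendable_map_extend[OF U F(1) G H]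
  have "\<exists>P. (\<forall>n. P n \<in> ?S \<and> P n \<subseteq> P (Suc n)) \<and>
    (\<forall>n. \<forall>t\<in>carrier G <+> carrier H. \<exists>k>n. ?Q (P n) t (P k))"
  proof (rule exists_chain_meeting_tasks[OF p0])
    fix p assume "p \<in> ?S"
    then show "\<exists>p'\<in>?S. p \<subseteq> p'" by blast
  next
    fix p p' t assume "p' \<in> ?S" and t: "t \<in> carrier G <+> carrier H"
    then have p': "extendable_map L F G H p'" by simp
    show "\<exists>z\<in>?S. p' \<subseteq> z \<and> ?Q p t z"
    proof (cases t)
      case (Inl x)
      then show ?thesis using ext[OF p', of "{x}" "{}"] t by auto
    next
      case (Inr y)
      then show ?thesis using ext[OF p', of "{}" "{y}"] t by auto
    qed
  qed (use cnt in auto)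
  \<comment> \<open>The task set is the same at every stage, so the tasks of stage 0 already cover
    all points.\<close>
  then obtain P where P: "\<And>n. extendable_map L F G H (P n)" "\<And>n. P n \<subseteq> P (Suc n)"
    and tasks: "\<And>t. t \<in> carrier G <+> carrier H \<Longrightarrow> \<exists>k. ?Q (P 0) t (P k)"
    unfolding mem_Collect_eq by metis
  \<comment> \<open>The larger domains \<open>B\<close> are dropped here: the maps are only known to
    cohere on the sets \<open>A\<close>.\<close>
  have "\<exists>A q. substructure L A G \<and> embedding L q A H \<and> P n = (\<lambda>a. (a, q a)) ` carrier A" for n
    using P(1)[of n] embedding_restrict substructure_trans
    unfolding extendable_map_def anchored_def by metis
  then obtain A q where A: "\<And>n. substructure L (A n) G" and q: "\<And>n. embedding L (q n) (A n) H"
    and Pn: "\<And>n. P n = (\<lambda>a. (a, q n a)) ` carrier (A n)"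
    by metis
  have mono: "P m \<subseteq> P n" if "m \<le> n" for m n
    using P(2) that by (rule lift_Suc_mono_le)
  have dom: "Domain (P n) = carrier (A n)" for n by (force simp: Pn)
  have cA: "carrier (A m) \<subseteq> carrier (A n)" if "m \<le> n" for m n
    using mono[OF that] dom by (metis Domain_mono)
  have ch: "substructure L (A n) (A (Suc n))" for n
    using A[of n] A[of "Suc n"] cA[of n "Suc n"] by (auto simp: substructure_def tuples_def)
  \<comment> \<open>Both pairs lie in \<open>P (max m n)\<close>, which is the graph of a
    function.\<close>
  have agree: "q m x = q n x" if "x \<in> carrier (A m)" "x \<in> carrier (A n)" for m n x
  proof -
    have "(x, q m x) \<in> P (max m n)" "(x, q n x) \<in> P (max m n)"
      using that mono[of m "max m n"] mono[of n "max m n"] by (auto simp: Pn)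
    then show ?thesis by (auto simp: Pn)
  qed
  have cG: "carrier G = (\<Union>n. carrier (A n))"
  proof
    show "carrier G \<subseteq> (\<Union>n. carrier (A n))"
    proof
      fix x assume "x \<in> carrier G"
      then show "x \<in> (\<Union>n. carrier (A n))" using tasks[of "Inl x"] dom by auto
    qed
    show "(\<Union>n. carrier (A n)) \<subseteq> carrier G"
      using A unfolding substructure_def by blast
  qed
  define h where "h x = q (SOME n. x \<in> carrier (A n)) x" for x
  have h: "h x = q n x" if "x \<in> carrier (A n)" for x n
    unfolding h_def by (rule agree[OF _ that]) (use that in \<open>rule someI\<close>)
  have "embedding L h (A n) H" for n
    by (rule embedding_cong[OF q]) (simp add: h)
  then have emb: "embedding L h G H"
    using embedding_from_chain_union[of L A, OF ch A cG] by blast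
  moreover have "y \<in> h ` carrier G" if y: "y \<in> carrier H" for y
  proof -
    obtain k where "y \<in> Range (P k)" using tasks[of "Inr y"] y by auto
    then obtain x where "x \<in> carrier (A k)" "y = q k x" by (auto simp: Pn)
    then have "h x = y" "x \<in> carrier G" using h cG by auto
    then show ?thesis by blast
  qed
  ultimately show ?thesis
    unfolding isomorphic_def using embedding_image_subset[OF emb] by blast
qed

subsection \<open>Existence\<close>

text \<open>Chooses one member from each class; reflexivity ensures that no class is empty.\<close>

lemma countable_representatives:
  assumes "countably_many_iso_types L F" and st: "\<And>X. X \<in> F \<Longrightarrow> is_structure L X"
  shows "\<exists>R. countable R \<and> R \<subseteq> F \<and> (\<forall>X\<in>F. \<exists>Y\<in>R. isomorphic L X Y)"
proof -
  let ?r = "{(X, Y). X \<in> F \<and> Y \<in> F \<and> isomorphic L X Y}"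
  let ?R = "(\<lambda>c. SOME Y. Y \<in> c) ` (F // ?r)"
  have rep: "(SOME Y. Y \<in> ?r `` {X}) \<in> ?r `` {X}" if "X \<in> F" for X
    by (rule someI[of _ X]) (use that isomorphic_refl[OF st[OF that]] in simp)
  have "countable ?R" using assms by (simp add: countably_many_iso_types_def)
  moreover have "?R \<subseteq> F" using rep by (auto simp: quotient_def)
  moreover have "\<exists>Y\<in>?R. isomorphic L X Y" if "X \<in> F" for X
  proof (rule bexI)
    show "isomorphic L X (SOME Y. Y \<in> ?r `` {X})" using rep[OF that] by blast
    show "(SOME Y. Y \<in> ?r `` {X}) \<in> ?R"
      by (rule imageI[of "?r `` {X}" "F // ?r" "\<lambda>c. SOME Y. Y \<in> c", OF quotientI[OF that]])
  qed
  ultimately show ?thesis by (intro exI[of _ ?R] conjI ballI)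
qed

text \<open>A task at stage \<open>X\<close> is a representative \<open>Y\<close> with a list of
  intended images of the generators of \<open>W X\<close>. To meet it at a later stage
  \<open>S\<close>, the coded embedding is amalgamated with the inclusion of \<open>W X\<close> in
  \<open>W S\<close>.\<close>

lemma exists_absorbing_chain:
  fixes F :: "('u, 'f, 'r) fo_struct set"
  assumes U: "uncountable (UNIV :: 'u set)" and F: "weak_Fraisse_class L F" "F \<noteq> {}"
  shows "\<exists>X W. (\<forall>n. X n \<in> F \<and> W n \<in> F \<and> substructure L (X n) (W n) \<and>
      substructure L (W n) (X (Suc n)) \<and>
      (\<forall>Y\<in>F. \<forall>f. embedding L f (W n) Y \<longrightarrow>
        (\<exists>k g. embedding L g Y (X k) \<and> (\<forall>x\<in>carrier (X n). g (f x) = x))))"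
proof -
  have sc: "structure_class L F" using F by (simp add: weak_Fraisse_class_def)
  then have iso: "iso_closed L F" by (simp add: structure_class_def)
  have fg: "finitely_generated L X" "countable (carrier X)" "is_structure L X" if "X \<in> F" for X
    using sc that by (auto simp: structure_class_def finitely_generated_def)
  obtain Rp where Rp: "countable Rp" "Rp \<subseteq> F" "\<And>X. X \<in> F \<Longrightarrow> \<exists>Y\<in>Rp. isomorphic L X Y"
    using countable_representatives[of L F] F fg(3) unfolding weak_Fraisse_class_def by metis
  have "WAP L F" using F by (simp add: weak_Fraisse_class_def)
  then obtain W where W: "\<And>Z. Z \<in> F \<Longrightarrow> W Z \<in> F" "\<And>Z. Z \<in> F \<Longrightarrow> substructure L Z (W Z)"
    and am: "\<And>Z X Y f g. Z \<in> F \<Longrightarrow> X \<in> F \<Longrightarrow> Y \<in> F \<Longrightarrow> embedding L f (W Z) X \<Longrightarrow>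
       embedding L g (W Z) Y \<Longrightarrow> \<exists>V\<in>F. \<exists>f' g'. embedding L f' X V \<and> embedding L g' Y V \<and>
           (\<forall>z\<in>carrier Z. f' (f z) = g' (g z))"
    unfolding WAP_def by metis
  have "\<exists>xs. generates L (set xs) X" if "X \<in> F" for X
    using fg(1)[OF that] finite_list unfolding finitely_generated_iff by metis
  then obtain gen where gen: "\<And>X. X \<in> F \<Longrightarrow> generates L (set (gen X)) X" by metis
  \<comment> \<open>Demanding \<open>W X\<close> below \<open>Y\<close>, not just \<open>X\<close>,
    interleaves the WAP witnesses with the chain.\<close>
  define R where "R X Y \<longleftrightarrow> X \<in> F \<and> Y \<in> F \<and> substructure L (W X) Y" for X Y
  define T where "T X = (SIGMA Y:Rp. lists (carrier Y))" for X :: "('u, 'f, 'r) fo_struct"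
  \<comment> \<open>All embeddings with the prescribed generator images agree on \<open>W X\<close>,
    so treating one of them settles the task.\<close>
  define Q where "Q X t Z \<longleftrightarrow> (\<forall>f. embedding L f (W X) (fst t) \<and> map f (gen (W X)) = snd t \<longrightarrow>
      (\<exists>g. embedding L g (fst t) Z \<and> (\<forall>x\<in>carrier X. g (f x) = x)))"
    for X :: "('u, 'f, 'r) fo_struct" and t :: "('u, 'f, 'r) fo_struct \<times> 'u list" and Z
  obtain X0 where X0: "X0 \<in> F" using F by blast
  have "\<exists>X. (\<forall>n. X n \<in> F \<and> R (X n) (X (Suc n))) \<and> (\<forall>n. \<forall>t\<in>T (X n). \<exists>k>n. Q (X n) t (X k))"
  proof (rule exists_chain_meeting_tasks[OF X0])
    fix X Y Z assume "R X Y" "R Y Z"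
    then show "R X Z" unfolding R_def using W substructure_trans by metis
  next
    fix X
    show "countable (T X)"
      unfolding T_def using Rp fg by (intro countable_SIGMA countable_lists) auto
  next
    fix X assume "X \<in> F"
    then show "\<exists>Y\<in>F. R X Y"
      unfolding R_def using W substructure_refl fg(3) by metis
  next
    fix X S t assume X: "X \<in> F" and S: "S \<in> F" and XS: "X = S \<or> R X S" and "t \<in> T X"
    then obtain Y ys where t: "t = (Y, ys)" and "Y \<in> Rp" by (auto simp: T_def)
    then have Y: "Y \<in> F" using Rp by blast
    have XWS: "substructure L (W X) (W S)"
      using XS W S substructure_trans substructure_refl[OF fg(3)] unfolding R_def by metis
    show "\<exists>Z\<in>F. R S Z \<and> Q X t Z"
    proof (cases "\<exists>f. embedding L f (W X) Y \<and> map f (gen (W X)) = ys")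
      \<comment> \<open>The list codes no embedding, so the task holds vacuously and
        \<open>W S\<close> can be the next stage.\<close>
      case False
      moreover have "R S (W S)" using W S substructure_refl[OF fg(3)] by (simp add: R_def)
      ultimately show ?thesis using W(1)[OF S] by (auto simp: Q_def t)
    next
      case True
      then obtain f where f: "embedding L f (W X) Y" "map f (gen (W X)) = ys" by blast
      obtain V f' g' where V: "V \<in> F" "embedding L f' Y V" "embedding L g' (W S) V"
        "\<And>x. x \<in> carrier X \<Longrightarrow> f' (f x) = g' x"
        using am[OF X Y W(1)[OF S] f(1) XWS[unfolded substructure_iff_embedding]] by blast
      \<comment> \<open>Renaming the amalgam turns \<open>g'\<close> into the inclusion of
        \<open>W S\<close>.\<close>
      obtain V' h where h: "embedding L h V V'" "h ` carrier V = carrier V'"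
        "substructure L (W S) V'" "\<And>x. x \<in> carrier (W S) \<Longrightarrow> h (g' x) = x"
        using exists_copy_above[OF U V(3) fg(2)[OF V(1)]] by blast
      have V': "V' \<in> F" using iso_closed_image[OF iso V(1) h(1,2)] .
      have "Q X t V'"
        unfolding Q_def t
      proof (intro allI impI)
        fix f1 assume "embedding L f1 (W X) (fst (Y, ys)) \<and> map f1 (gen (W X)) = snd (Y, ys)"
        then have f1: "embedding L f1 (W X) Y" "map f1 (gen (W X)) = map f (gen (W X))"
          using f by auto
        have "h (f' (f1 x)) = x" if x: "x \<in> carrier X" for x
        proof -
          have xW: "x \<in> carrier (W X)" using x W(2)[OF X] by (auto simp: substructure_def)
          have "f1 x = f x"
            using embeddings_eq_on_generators[OF gen[OF W(1)[OF X]] f1(1) f(1) _ xW] f1(2)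
            by (simp add: map_eq_conv)
          moreover have "x \<in> carrier (W S)" using xW XWS by (auto simp: substructure_def)
          ultimately show ?thesis using V(4)[OF x] h(4) by simp
        qed
        then show "\<exists>g. embedding L g (fst (Y, ys)) V' \<and> (\<forall>x\<in>carrier X. g (f1 x) = x)"
          using embedding_compose[OF V(2) h(1)] by auto
      qed
      then show ?thesis using V' S h(3) by (auto simp: R_def)
    qed
  qed
  then obtain X where X: "\<And>n. X n \<in> F" "\<And>n. R (X n) (X (Suc n))"
    and tasks: "\<And>n t. t \<in> T (X n) \<Longrightarrow> \<exists>k>n. Q (X n) t (X k)"
    by blast
  have "\<exists>k g. embedding L g Y (X k) \<and> (\<forall>x\<in>carrier (X n). g (f x) = x)"
    if Y: "Y \<in> F" and f: "embedding L f (W (X n)) Y" for n Y f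
  proof -
    \<comment> \<open>Tasks mention representatives only, so \<open>f\<close> is first carried along
      an isomorphism \<open>i\<close> and the solution is composed with \<open>i\<close>
      afterwards.\<close>
    obtain Y' i where Y': "Y' \<in> Rp" and i: "embedding L i Y Y'"
      using Rp(3)[OF Y] by (auto simp: isomorphic_def)
    let ?f = "\<lambda>x. i (f x)"
    have f': "embedding L ?f (W (X n)) Y'" using embedding_compose[OF f i] .
    have "set (gen (W (X n))) \<subseteq> carrier (W (X n))"
      using gen[OF W(1)[OF X(1)]] by (simp add: generates_def)
    then have "(Y', map ?f (gen (W (X n)))) \<in> T (X n)"
      using Y' embedding_image_subset[OF f'] by (auto simp: T_def image_subset_iff subset_iff)
    then obtain k where "Q (X n) (Y', map ?f (gen (W (X n)))) (X k)" using tasks by blast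
    then obtain g where "embedding L g Y' (X k)" "\<forall>x\<in>carrier (X n). g (?f x) = x"
      using f' by (auto simp: Q_def)
    then show ?thesis using embedding_compose[OF i] by blast
  qed
  moreover have "substructure L (W (X n)) (X (Suc n))" for n
    using X(2)[of n] by (simp add: R_def)
  ultimately show ?thesis
    using X(1) W by (intro exI[of _ X] exI[of _ "\<lambda>n. W (X n)"]) simp
qed

text \<open>In the union of an absorbing chain, a substructure \<open>A\<close> from
  \<open>F\<close> lies in some \<open>X n\<close>, and \<open>W n\<close> anchors it.\<close>

lemma exists_weakly_injective_for:
  fixes F :: "('u, 'f, 'r) fo_struct set"
  assumes U: "uncountable (UNIV :: 'u set)" and F: "weak_Fraisse_class L F" "F \<noteq> {}"
  shows "\<exists>G. weakly_injective_for L F G"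
proof -
  have fg: "finitely_generated L X" if "X \<in> F" for X
    using F that by (auto simp: weak_Fraisse_class_def structure_class_def)
  have jep: "JEP L F" using F by (simp add: weak_Fraisse_class_def)
  obtain X W where X: "\<And>n. X n \<in> F" and W: "\<And>n. W n \<in> F"
    and XW: "\<And>n. substructure L (X n) (W n)" and WX: "\<And>n. substructure L (W n) (X (Suc n))"
    and abs: "\<And>n Y f. Y \<in> F \<Longrightarrow> embedding L f (W n) Y \<Longrightarrow>
        \<exists>k g. embedding L g Y (X k) \<and> (\<forall>x\<in>carrier (X n). g (f x) = x)"
    using exists_absorbing_chain[OF U F] by metis
  have ch: "substructure L (X n) (X (Suc n))" for n
    using XW WX substructure_trans by blast
  define G where "G = chain_union L X"
  have XG: "substructure L (X n) G" for n
    unfolding G_def using substructure_chain_union[of L X, OF ch] .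
  have cG: "carrier G = (\<Union>n. carrier (X n))" by (simp add: G_def)
  have "G \<in> sigma_class L F"
    unfolding sigma_class_def using X ch XG cG by blast
  moreover have "embeds L Y G" if Y: "Y \<in> F" for Y
  proof -
    \<comment> \<open>Absorption applies only to extensions of some \<open>W n\<close>; the JEP
      places \<open>Y\<close> inside such an extension.\<close>
    obtain Z f g where Z: "Z \<in> F" "embedding L f (W 0) Z" "embedding L g Y Z"
      using jep W[of 0] Y unfolding JEP_def embeds_def by metis
    then obtain k g' where "embedding L g' Z (X k)" using abs by blast
    then have "embedding L (\<lambda>y. g' (g y)) Y G"
      using embedding_compose[OF Z(3)] embedding_substructure XG by blast
    then show ?thesis by (auto simp: embeds_def)
  qed
  moreover have "\<exists>B. anchored L F G A B" if A: "A \<in> F" "substructure L A G" for A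
  proof -
    obtain S where S: "finite S" "generates L S A" using fg[OF A(1)] by (auto simp: finitely_generated_iff)
    have "S \<subseteq> carrier G" using S A by (metis generates_def order_trans substructure_def)
    then obtain n where n: "S \<subseteq> carrier (X n)"
      using finite_subset_chain[of L X S, OF ch S(1)] cG by auto
    have AX: "substructure L A (X n)" using substructure_common_target[OF S(2) A(2) XG n] .
    have "\<exists>f. embedding L f Y G \<and> (\<forall>a\<in>carrier A. f a = a)"
      if Y: "Y \<in> F" "substructure L (W n) Y" for Y
    proof -
      obtain k g where "embedding L g Y (X k)" "\<forall>x\<in>carrier (X n). g x = x"
        using abs[OF Y(1) Y(2)[unfolded substructure_iff_embedding]] by auto
      then show ?thesis
        using AX XG embedding_substructure unfolding substructure_def[of L A] by blast
    qed
    moreover have "substructure L A (W n)" "substructure L (W n) G"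
      using AX XW WX XG substructure_trans by blast+
    ultimately show ?thesis using A W unfolding anchored_def by blast
  qed
  ultimately show ?thesis
    unfolding weakly_injective_for_def anchored_def by blast
qed

text \<open>A finitely generated structure mapped into \<open>G\<close> already maps into a member
  of \<open>F\<close>, whose copy above it is again in \<open>F\<close>.\<close>

lemma cofinal_in_Age:
  fixes F :: "('u, 'f, 'r) fo_struct set"
  assumes U: "uncountable (UNIV :: 'u set)" and F: "structure_class L F"
    and G: "weakly_injective_for L F G"
  shows "cofinal_in L F (Age L G)"
  unfolding cofinal_in_def
proof (intro conjI ballI)
  show "F \<subseteq> Age L G"
    using F G by (auto simp: Age_def structure_class_def weakly_injective_for_def)
  fix X assume "X \<in> Age L G"
  then obtain u where X: "finitely_generated L X" "embedding L u X G"
    by (auto simp: Age_def embeds_def)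
  then obtain C where C: "C \<in> F" "embedding L u X C"
    using sigma_class_common_target[of G L F X u X u] G by (auto simp: weakly_injective_for_def)
  moreover have "countable (carrier C)" using C(1) F by (simp add: structure_class_def)
  ultimately obtain C' h where "embedding L h C C'" "h ` carrier C = carrier C'" "substructure L X C'"
    using exists_copy_above[OF U C(2)] by blast
  then show "\<exists>Y\<in>F. substructure L X Y"
    using iso_closed_image[OF _ C(1)] F by (auto simp: structure_class_def)
qed

subsection \<open>Cofinal subclasses of the age of a weakly injective structure\<close>

lemma iso_closed_Age:
  fixes G :: "('u, 'f, 'r) fo_struct"
  shows "iso_closed L (Age L G)"
  unfolding iso_closed_def
proof (intro ballI allI impI)
  fix X Y :: "('u, 'f, 'r) fo_struct"
  assume X: "X \<in> Age L G" and XY: "isomorphic L X Y"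
  obtain h e where "embedding L h Y X" "embedding L e X G"
    using X isomorphic_sym[OF XY] by (auto simp: Age_def embeds_def isomorphic_def)
  then have "embeds L Y G" using embedding_compose unfolding embeds_def by blast
  then show "Y \<in> Age L G"
    using X XY finitely_generated_isomorphic by (auto simp: Age_def)
qed

lemma countable_Age_member:
  assumes "countable (carrier G)" "X \<in> Age L G"
  shows "countable (carrier X)"
proof -
  obtain e where "embedding L e X G" using assms(2) by (auto simp: Age_def embeds_def)
  then show ?thesis
    using assms(1) by (metis countable_image_inj_on countable_subset embedding_def)
qed

text \<open>The images of \<open>X\<close> and \<open>Y\<close> in \<open>G\<close> are
  substructures generated by the same set, hence equal.\<close>

lemma isomorphic_if_images_generated:
  assumes X: "generates L S X" "embedding L e X G" and Y: "generates L T Y" "embedding L d Y G"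
    and eq: "e ` S = d ` T"
  shows "isomorphic L X Y"
proof -
  obtain A where A: "substructure L A G" "embedding L e X A" "e ` carrier X = carrier A"
    using embedding_image[OF X(2)] .
  obtain B where B: "substructure L B G" "embedding L d Y B" "d ` carrier Y = carrier B"
    using embedding_image[OF Y(2)] .
  have gA: "generates L (e ` S) A" using generates_image[OF X(1) A(2,3)] .
  have gB: "generates L (e ` S) B" unfolding eq using generates_image[OF Y(1) B(2,3)] .
  have "substructure L A B"
    using substructure_common_target[OF gA A(1) B(1)] gB by (simp add: generates_def)
  then have "A = B" using gA gB by (simp add: generates_def)
  then have "isomorphic L X A" "isomorphic L Y A" using A B by (auto simp: isomorphic_def)
  then show ?thesis using isomorphic_sym isomorphic_trans by blast
qed

text \<open>Each member is coded by the finite set of generator images in \<open>G\<close>. Equal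
  codes give isomorphic structures, and a countable set has only countably many finite
  subsets.\<close>

lemma countably_many_iso_types_subset_Age:
  assumes G: "countable (carrier G)" and F: "F \<subseteq> Age L G"
  shows "countably_many_iso_types L F"
proof -
  let ?r = "{(X, Y). X \<in> F \<and> Y \<in> F \<and> isomorphic L X Y}"
  have "\<exists>S e. finite S \<and> generates L S X \<and> embedding L e X G" if "X \<in> F" for X
    using that F unfolding Age_def finitely_generated_iff embeds_def by blast
  then obtain S e where S: "\<And>X. X \<in> F \<Longrightarrow> finite (S X) \<and> generates L (S X) X \<and> embedding L (e X) X G"
    by metis
  define c where "c X = e X ` S X" for X
  \<comment> \<open>\<open>k\<close> decodes: any member of \<open>F\<close> with code
    \<open>E\<close> yields the right class.\<close>
  define k where "k E = ?r `` {SOME X. X \<in> F \<and> c X = E}" for E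
  have c: "c X \<in> {E. finite E \<and> E \<subseteq> carrier G}" if "X \<in> F" for X
    using S[OF that] embedding_image_subset unfolding c_def generates_def by fastforce
  have "?r `` {X} = k (c X)" if X: "X \<in> F" for X
  proof -
    define Y where "Y = (SOME Y. Y \<in> F \<and> c Y = c X)"
    have Y: "Y \<in> F" "c Y = c X" using someI[of "\<lambda>Y. Y \<in> F \<and> c Y = c X" X] X by (auto simp: Y_def)
    then have "isomorphic L X Y"
      using isomorphic_if_images_generated S[OF X] S[OF Y(1)] unfolding c_def by metis
    then have "isomorphic L X Z \<longleftrightarrow> isomorphic L Y Z" for Z
      using isomorphic_sym isomorphic_trans by blast
    then show ?thesis unfolding k_def Y_def[symmetric] using X Y by auto
  qed
  then have "F // ?r \<subseteq> k ` {E. finite E \<and> E \<subseteq> carrier G}"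
    using c by (auto simp: quotient_def)
  moreover have "countable {E. finite E \<and> E \<subseteq> carrier G}"
    using countable_Collect_finite_subset[OF G] .
  ultimately show ?thesis
    unfolding countably_many_iso_types_def by (meson countable_image countable_subset)
qed

text \<open>Since \<open>G\<close> is the union of a chain from its age, two members of
  \<open>F\<close> meet in one member of the age, which cofinality enlarges into
  \<open>F\<close>.\<close>

lemma JEP_cofinal_in_Age:
  assumes G: "weakly_injective L G" and F: "cofinal_in L F (Age L G)"
  shows "JEP L F"
  unfolding JEP_def
proof (intro ballI)
  fix X Y assume "X \<in> F" "Y \<in> F"
  then have "X \<in> Age L G" "Y \<in> Age L G" using F by (auto simp: cofinal_in_def)
  then obtain u v where "finitely_generated L X" "embedding L u X G"
    "finitely_generated L Y" "embedding L v Y G"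
    by (auto simp: Age_def embeds_def)
  then obtain C where C: "C \<in> Age L G" "embedding L u X C" "embedding L v Y C"
    using sigma_class_common_target G unfolding weakly_injective_def weakly_injective_for_def by metis
  then obtain Z where "Z \<in> F" "substructure L C Z" using F by (auto simp: cofinal_in_def)
  then show "\<exists>Z\<in>F. embeds L X Z \<and> embeds L Y Z"
    using C embedding_substructure unfolding embeds_def by blast
qed

text \<open>Anchoring speaks of superstructures of \<open>B\<close>; passing to a copy of
  \<open>X\<close> above \<open>B\<close> extends it to arbitrary embeddings of
  \<open>B\<close>.\<close>

lemma weakly_injective_extend_along:
  fixes G :: "('u, 'f, 'r) fo_struct"
  assumes U: "uncountable (UNIV :: 'u set)" and iso: "iso_closed L F"
    and cnt: "countable (carrier X)" and B: "anchored L F G A B"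
    and f: "embedding L f B X" and X: "X \<in> F"
  shows "\<exists>u. embedding L u X G \<and> (\<forall>a\<in>carrier A. u (f a) = a)"
proof -
  obtain X' h where h: "embedding L h X X'" "h ` carrier X = carrier X'" "substructure L B X'"
    "\<And>x. x \<in> carrier B \<Longrightarrow> h (f x) = x"
    using exists_copy_above[OF U f cnt] by blast
  then obtain u where u: "embedding L u X' G" "\<forall>a\<in>carrier A. u a = a"
    using B iso_closed_image[OF iso X h(1,2)] by (auto simp: anchored_def)
  have "carrier A \<subseteq> carrier B" using B by (simp add: anchored_def substructure_def)
  then show ?thesis
    using u h(4) embedding_compose[OF h(1) u(1)] by (metis subsetD)
qed

text \<open>The image \<open>A\<close> of \<open>Z\<close> in \<open>G\<close> is anchored by
  \<open>B\<close>, and the WAP witness is a member of \<open>F\<close> above a copy of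
  \<open>B\<close>. Its extensions map into \<open>G\<close> compatibly with \<open>e\<close>, so
  two of them amalgamate inside \<open>G\<close>.\<close>

lemma WAP_cofinal_in_Age:
  fixes G :: "('u, 'f, 'r) fo_struct"
  assumes U: "uncountable (UNIV :: 'u set)" and cG: "countable (carrier G)"
    and G: "weakly_injective L G" and F: "cofinal_in L F (Age L G)"
  shows "WAP L F"
  unfolding WAP_def
proof (intro ballI)
  have G': "weakly_injective_for L (Age L G) G" using G by (simp add: weakly_injective_def)
  have FA: "F \<subseteq> Age L G" and cof: "\<And>X. X \<in> Age L G \<Longrightarrow> \<exists>Y\<in>F. substructure L X Y"
    using F by (auto simp: cofinal_in_def)
  fix Z assume "Z \<in> F"
  then have Z: "Z \<in> Age L G" using FA by blast
  then obtain e where e: "embedding L e Z G" by (auto simp: Age_def embeds_def)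
  obtain A where A: "substructure L A G" "embedding L e Z A" "e ` carrier Z = carrier A"
    using embedding_image[OF e] .
  have "A \<in> Age L G" using iso_closed_image[OF iso_closed_Age Z A(2,3)] .
  then obtain B where B: "anchored L (Age L G) G A B"
    using weakly_injective_for_anchored[OF G' _ A(1)] by blast
  then have BA: "B \<in> Age L G" and AB: "substructure L A B" by (simp_all add: anchored_def)
  \<comment> \<open>\<open>B\<close> is renamed so as to contain \<open>Z\<close> itself instead of
    its image \<open>A\<close>.\<close>
  obtain B' h where h: "embedding L h B B'" "h ` carrier B = carrier B'" "substructure L Z B'"
    "\<And>z. z \<in> carrier Z \<Longrightarrow> h (e z) = z"
    using exists_copy_above[OF U embedding_substructure[OF A(2) AB] countable_Age_member[OF cG BA]]
    by blast
  have "B' \<in> Age L G" using iso_closed_image[OF iso_closed_Age BA h(1,2)] .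
  then obtain Z' where Z': "Z' \<in> F" "substructure L B' Z'" using cof by blast
  \<comment> \<open>Through \<open>h\<close>, an embedding of \<open>Z'\<close> into
    \<open>X\<close> makes \<open>X\<close> an extension of \<open>B\<close>, so \<open>X\<close>
    maps into \<open>G\<close> fixing \<open>A\<close>; on \<open>Z\<close> this gives
    \<open>e\<close>.\<close>
  have ret: "\<exists>u. embedding L u X G \<and> (\<forall>z\<in>carrier Z. u (f z) = e z)"
    if X: "X \<in> F" and f: "embedding L f Z' X" for X f
  proof -
    have XA: "X \<in> Age L G" using X FA by blast
    have "embedding L (\<lambda>x. f (h x)) B X"
      using embedding_compose[OF h(1) embedding_restrict[OF Z'(2) f]] .
    then obtain u where "embedding L u X G" "\<forall>a\<in>carrier A. u (f (h a)) = a"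
      using weakly_injective_extend_along[OF U iso_closed_Age countable_Age_member[OF cG XA] B _ XA]
      by blast
    then show ?thesis using A(3) h(4) by force
  qed
  show "\<exists>Z'\<in>F. substructure L Z Z' \<and> (\<forall>X\<in>F. \<forall>Y\<in>F. \<forall>f g. embedding L f Z' X \<and>
     embedding L g Z' Y \<longrightarrow> (\<exists>V\<in>F. \<exists>f' g'. embedding L f' X V \<and> embedding L g' Y V \<and>
           (\<forall>z\<in>carrier Z. f' (f z) = g' (g z))))"
  proof (rule bexI[OF _ Z'(1)], intro conjI ballI allI impI)
    show "substructure L Z Z'" using substructure_trans[OF h(3) Z'(2)] .
    fix X Y f g assume X: "X \<in> F" and Y: "Y \<in> F" and fg: "embedding L f Z' X \<and> embedding L g Z' Y"
    obtain u where u: "embedding L u X G" "\<forall>z\<in>carrier Z. u (f z) = e z" using ret[OF X] fg by blast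
    obtain v where v: "embedding L v Y G" "\<forall>z\<in>carrier Z. v (g z) = e z" using ret[OF Y] fg by blast
    have "finitely_generated L X" "finitely_generated L Y" using X Y FA by (auto simp: Age_def)
    then obtain C where C: "C \<in> Age L G" "embedding L u X C" "embedding L v Y C"
      using sigma_class_common_target u(1) v(1) G' unfolding weakly_injective_for_def by metis
    \<comment> \<open>\<open>C\<close> is only known to be in the age; cofinality moves the amalgam
      into \<open>F\<close>.\<close>
    obtain V where V: "V \<in> F" "substructure L C V" using cof[OF C(1)] by blast
    have "embedding L u X V" "embedding L v Y V"
      using C V embedding_substructure by blast+
    then show "\<exists>V\<in>F. \<exists>f' g'. embedding L f' X V \<and> embedding L g' Y V \<and>
           (\<forall>z\<in>carrier Z. f' (f z) = g' (g z))"
      using V(1) u(2) v(2) by (intro bexI[of _ V] exI[of _ u] exI[of _ v]) auto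
  qed
qed

lemma weak_Fraisse_class_cofinal_in_Age:
  fixes G :: "('u, 'f, 'r) fo_struct"
  assumes U: "uncountable (UNIV :: 'u set)" and cG: "countable (carrier G)"
    and G: "weakly_injective L G" and F: "iso_closed L F" "cofinal_in L F (Age L G)"
  shows "weak_Fraisse_class L F"
proof -
  have FA: "F \<subseteq> Age L G" using F by (simp add: cofinal_in_def)
  have "structure_class L F"
    using FA F(1) countable_Age_member[OF cG] by (auto simp: structure_class_def Age_def)
  then show ?thesis
    unfolding weak_Fraisse_class_def
    using JEP_cofinal_in_Age[OF G F(2)] WAP_cofinal_in_Age[OF U cG G F(2)]
      countably_many_iso_types_subset_Age[OF cG FA] by blast
qed

theorem theorem5p1:
  fixes L :: "('f, 'r) signature"
  assumes "countable_signature L"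
    and "uncountable (UNIV :: 'u set)"
  shows
    "(\<forall>F :: ('u, 'f, 'r) fo_struct set. F \<noteq> {} \<and> weak_Fraisse_class L F \<longrightarrow>
        (\<exists>G. (G \<in> sigma_class L F \<and> weakly_injective_for L F G \<and> cofinal_in L F (Age L G)) \<and>
           (\<forall>H. H \<in> sigma_class L F \<and> weakly_injective_for L F H \<and> cofinal_in L F (Age L H)
              \<longrightarrow> isomorphic L G H))) \<and>
     (\<forall>G :: ('u, 'f, 'r) fo_struct. is_structure L G \<and> countable (carrier G) \<and> weakly_injective L G \<longrightarrow>
        (\<forall>F. iso_closed L F \<and> cofinal_in L F (Age L G) \<longrightarrow> weak_Fraisse_class L F))"
proof (intro conjI allI impI)
  fix F :: "('u, 'f, 'r) fo_struct set"
  assume F: "F \<noteq> {} \<and> weak_Fraisse_class L F"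
  then have sc: "structure_class L F" by (simp add: weak_Fraisse_class_def)
  obtain G where G: "weakly_injective_for L F G"
    using exists_weakly_injective_for[OF assms(2)] F by blast
  show "\<exists>G. (G \<in> sigma_class L F \<and> weakly_injective_for L F G \<and> cofinal_in L F (Age L G)) \<and>
           (\<forall>H. H \<in> sigma_class L F \<and> weakly_injective_for L F H \<and> cofinal_in L F (Age L H)
              \<longrightarrow> isomorphic L G H)"
    using G cofinal_in_Age[OF assms(2) sc G] weakly_injective_for_unique[OF assms(2) sc _ G] F
    by (intro exI[of _ G]) (auto simp: weakly_injective_for_def[of L F G])
qed (use weak_Fraisse_class_cofinal_in_Age[OF assms(2)] in blast)

end
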